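(* Let $m=ab\in\mathbb{Z}$ be nonzero, neither a unit nor a prime, with $a,b\in\mathbb{Z}$ coprime, and let $r,s\in\mathbb{Z}$ with $ar+bs=1$. Let $X$ be a finite alphabet, $\mathcal{P}_m=(\mathbb{Z}/m\mathbb{Z})\langle X\rangle$, with a fixed monomial well-ordering on the set $\mathcal{B}$ of words in $X$. Let $\pi:\mathbb{Z}\langle X\rangle\to\mathcal{P}_m$, $\pi_a:\mathcal{P}_m\to(\mathbb{Z}/a\mathbb{Z})\langle X\rangle$ and $\pi_b:\mathcal{P}_m\to(\mathbb{Z}/b\mathbb{Z})\langle X\rangle$ be the canonical projections. Let $\mathcal{J}$ be a two-sided ideal of $\mathcal{P}_m$ and let $\mathcal{G}_a=\{g_{a,i}\}_i$ and $\mathcal{G}_b=\{g_{b,j}\}_j$ be countable subsets of $\mathcal{P}_m$ such that: - $\pi_a(\mathcal{G}_a)\setminus\{0\}$ is a strong Gröbner basis for $\pi_a(\mathcal{J})$ and $\pi_b(\mathcal{G}_b)\setminus\{0\}$ is a strong Gröbner basis for $\pi_b(\mathcal{J})$; - $\pi(a)\in\mathcal{G}_a$ and $\pi(b)\in\mathcal{G}_b$; - $\pi(a)\nmid\mathrm{lc}(g_{a,i})$ and $\mathrm{lc}(g_{a,i})\mid\pi(a)$ for all $g_{a,i}\ne\pi(a)$, and $\pi(b)\nmid\mathrm{lc}(g_{b,j})$ and $\mathrm{lc}(g_{b,j})\mid\pi(b)$ for all $g_{b,j}\neq\pi(b)$. For indices $i,j$ and every overlap relation $\tau_{i,j}\,\mathrm{lm}(g_{a,i})=\tau_{j,i}\,\mathrm{lm}(g_{b,j})$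 (as specified in the context) put $$f_{i,j}:=\pi(ar)\,\mathrm{lc}(g_{a,i})\,\tau_{j,i}\,g_{b,j}+\pi(bs)\,\mathrm{lc}(g_{b,j})\,\tau_{i,j}\,g_{a,i}.$$ Then $\mathcal{G}:=\{f_{i,j}\mid \tau_{i,j}\,\mathrm{lm}(g_{a,i})=\tau_{j,i}\,\mathrm{lm}(g_{b,j})\}\setminus\{0\}$ is a strong Gröbner basis for $\mathcal{J}$.
   Context: **Notation.** For a commutative ring $\mathcal{R}$ (here $\mathbb{Z}/m\mathbb{Z}$, $\mathbb{Z}/a\mathbb{Z}$, $\mathbb{Z}/b\mathbb{Z}$), $\mathcal{P}=\mathcal{R}\langle X\rangle$ is the free associative algebra; $\mathcal{B}=\langle X\rangle$ is the free monoid of words (monomials), an $\mathcal{R}$-basis of $\mathcal{P}$. $\mathcal{B}^e=\{u\otimes v:u,v\in\mathcal{B}\}$ is the basis of $\mathcal{P}\otimes_{\mathcal{R}}\mathcal{P}^{\mathrm{opp}}$, acting by $(u\otimes v)\cdot t=utv$. $\mathrm{lm},\mathrm{lc},\mathrm{lt}=\mathrm{lc}\cdot\mathrm{lm}$ denote leading monomial, coefficient and term. A word $u$ divides $v$ if $v=\tau\cdot u$ for some $\tau\in\mathcal{B}^e$; a term $c\,u$ divides a term $c'v$ if $c\mid c'$ in $\mathcal{R}$ and $u$ divides $v$. **Strong Gröbner basis.** For $\mathcal{S}\subseteq\mathcal{P}$ let $\mathrm{L}(\mathcal{S})=\langle\mathrm{lt}(f):f\in\mathcal{S}\setminus\{0\}\rangle$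 (two-sided ideal). A countable set $\mathcal{G}\subseteq\mathcal{I}\setminus\{0\}$ is a strong Gröbner basis for a two-sided ideal $\mathcal{I}$ if $\mathrm{L}(\mathcal{I})\subseteq\mathrm{L}(\mathcal{G})$ and for every $f'\in\mathcal{I}\setminus\{0\}$ there is $g'\in\mathcal{G}$ with $\mathrm{lt}(g')$ dividing $\mathrm{lt}(f')$. **Overlap relations.** For a pair $(i,j)$ one considers all $\tau_{i,j},\tau_{j,i}\in\mathcal{B}^e$ with $\tau_{i,j}\,\mathrm{lm}(g_{a,i})=\tau_{j,i}\,\mathrm{lm}(g_{b,j})$ such that, for suitable words $x,x',y,y'\in\mathcal{B}$, one of the four cases holds: (i) $\tau_{i,j}=1\otimes x'$, $\tau_{j,i}=y\otimes1$; (ii) $\tau_{i,j}=x\otimes1$, $\tau_{j,i}=1\otimes y'$; (iii) $\tau_{i,j}=1\otimes1$, $\tau_{j,i}=y\otimes y'$; (iv) $\tau_{i,j}=x\otimes x'$, $\tau_{j,i}=1\otimes1$. These are not unique; $\mathcal{G}$ contains an element $f_{i,j}$ for each pair $(i,j)$ and each such overlap relation (including those where the two leading monomials are merely placed next to each other, possibly with a word in between). *)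

theory Defs
  imports "HOL-Algebra.IntRing" "HOL-Algebra.Module" "HOL-Algebra.Divisibility"
    "HOL-Library.Countable_Set"
begin

section \<open>Free associative algebras\<close>

text \<open>
  An element of the free associative algebra on the alphabet \<open>X\<close> is the family of its coefficients,
  indexed by words; \<open>lists X\<close> is the free monoid of words, with \<open>[]\<close> as unit and \<open>@\<close> as product.
\<close>

definition free_alg :: "('a, 'm) ring_scheme \<Rightarrow> 'x set \<Rightarrow> ('a, 'x list \<Rightarrow> 'a) module"
  where "free_alg R X = \<lparr>
    carrier = {f. (\<forall>w. f w \<in> carrier R) \<and> {w. f w \<noteq> \<zero>\<^bsub>R\<^esub>} \<subseteq> lists X \<and> finite {w. f w \<noteq> \<zero>\<^bsub>R\<^esub>}},
    mult = (\<lambda>f g w. \<Oplus>\<^bsub>R\<^esub>p \<in> {p. fst p @ snd p = w}. f (fst p) \<otimes>\<^bsub>R\<^esub> g (snd p)),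
    one = (\<lambda>w. if w = [] then \<one>\<^bsub>R\<^esub> else \<zero>\<^bsub>R\<^esub>),
    zero = (\<lambda>w. \<zero>\<^bsub>R\<^esub>),
    add = (\<lambda>f g w. f w \<oplus>\<^bsub>R\<^esub> g w),
    smult = (\<lambda>c f w. c \<otimes>\<^bsub>R\<^esub> f w)\<rparr>"

definition fa_term :: "('a, 'm) ring_scheme \<Rightarrow> 'a \<Rightarrow> 'x list \<Rightarrow> 'x list \<Rightarrow> 'a"
  where "fa_term R c u = (\<lambda>w. if w = u then c else \<zero>\<^bsub>R\<^esub>)"

abbreviation fa_const :: "('a, 'm) ring_scheme \<Rightarrow> 'a \<Rightarrow> 'x list \<Rightarrow> 'a"
  where "fa_const R c \<equiv> fa_term R c []"

text \<open>The basis element \<open>u \<otimes> v\<close> of the enveloping algebra is represented by the pair \<open>(u, v)\<close>.\<close>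

definition env_basis :: "'x set \<Rightarrow> ('x list \<times> 'x list) set"
  where "env_basis X = lists X \<times> lists X"

definition act_word :: "'x list \<times> 'x list \<Rightarrow> 'x list \<Rightarrow> 'x list"
  where "act_word \<tau> w = fst \<tau> @ w @ snd \<tau>"

definition act :: "('a, 'm) ring_scheme \<Rightarrow> 'x set \<Rightarrow> 'x list \<times> 'x list \<Rightarrow>
    ('x list \<Rightarrow> 'a) \<Rightarrow> 'x list \<Rightarrow> 'a"
  where "act R X \<tau> f =
    fa_term R \<one>\<^bsub>R\<^esub> (fst \<tau>) \<otimes>\<^bsub>free_alg R X\<^esub> f \<otimes>\<^bsub>free_alg R X\<^esub> fa_term R \<one>\<^bsub>R\<^esub> (snd \<tau>)"


section \<open>Leading terms and strong Groebner bases\<close>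

text \<open>\<open>(u, v) \<in> ord\<close> means that \<open>u\<close> is less than or equal to \<open>v\<close>.\<close>

definition monomial_well_order :: "'x set \<Rightarrow> 'x list rel \<Rightarrow> bool"
  where "monomial_well_order X ord \<longleftrightarrow> well_order_on (lists X) ord \<and>
    (\<forall>u \<in> lists X. \<forall>v \<in> lists X. \<forall>p \<in> lists X. \<forall>q \<in> lists X.
      (u, v) \<in> ord \<longrightarrow> (p @ u @ q, p @ v @ q) \<in> ord)"

text \<open>
  \<open>lm R ord f\<close> is meaningful for nonzero \<open>f\<close> only. Whatever word it denotes for the zero polynomial,
  the leading coefficient and the leading term of the zero polynomial are zero.
\<close>

definition lm :: "('a, 'm) ring_scheme \<Rightarrow> 'x list rel \<Rightarrow> ('x list \<Rightarrow> 'a) \<Rightarrow> 'x list"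
  where "lm R ord f = (THE w. f w \<noteq> \<zero>\<^bsub>R\<^esub> \<and> (\<forall>v. f v \<noteq> \<zero>\<^bsub>R\<^esub> \<longrightarrow> (v, w) \<in> ord))"

definition lc :: "('a, 'm) ring_scheme \<Rightarrow> 'x list rel \<Rightarrow> ('x list \<Rightarrow> 'a) \<Rightarrow> 'a"
  where "lc R ord f = f (lm R ord f)"

definition lt :: "('a, 'm) ring_scheme \<Rightarrow> 'x list rel \<Rightarrow> ('x list \<Rightarrow> 'a) \<Rightarrow> 'x list \<Rightarrow> 'a"
  where "lt R ord f = fa_term R (lc R ord f) (lm R ord f)"

definition word_divides :: "'x set \<Rightarrow> 'x list \<Rightarrow> 'x list \<Rightarrow> bool"
  where "word_divides X u v \<longleftrightarrow> (\<exists>\<tau> \<in> env_basis X. v = act_word \<tau> u)"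

definition lt_divides :: "('a, 'm) ring_scheme \<Rightarrow> 'x set \<Rightarrow> 'x list rel \<Rightarrow>
    ('x list \<Rightarrow> 'a) \<Rightarrow> ('x list \<Rightarrow> 'a) \<Rightarrow> bool"
  where "lt_divides R X ord g f \<longleftrightarrow>
    lc R ord g divides\<^bsub>R\<^esub> lc R ord f \<and> word_divides X (lm R ord g) (lm R ord f)"

definition lt_ideal :: "('a, 'm) ring_scheme \<Rightarrow> 'x set \<Rightarrow> 'x list rel \<Rightarrow>
    ('x list \<Rightarrow> 'a) set \<Rightarrow> ('x list \<Rightarrow> 'a) set"
  where "lt_ideal R X ord S = Idl\<^bsub>free_alg R X\<^esub> (lt R ord ` (S - {\<zero>\<^bsub>free_alg R X\<^esub>}))"

definition strong_groebner_basis :: "('a, 'm) ring_scheme \<Rightarrow> 'x set \<Rightarrow> 'x list rel \<Rightarrow>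
    ('x list \<Rightarrow> 'a) set \<Rightarrow> ('x list \<Rightarrow> 'a) set \<Rightarrow> bool"
  where "strong_groebner_basis R X ord I G \<longleftrightarrow>
    countable G \<and> G \<subseteq> I - {\<zero>\<^bsub>free_alg R X\<^esub>} \<and>
    lt_ideal R X ord I \<subseteq> lt_ideal R X ord G \<and>
    (\<forall>f \<in> I - {\<zero>\<^bsub>free_alg R X\<^esub>}. \<exists>g \<in> G. lt_divides R X ord g f)"


section \<open>Residue class rings and canonical projections\<close>

text \<open>
  \<open>ZFact n\<close> is the ring of cosets of \<open>n\<int>\<close>, and \<open>ZMod n k\<close> is the coset of \<open>k\<close>; both make sense for
  every integer \<open>n\<close>, including negative ones and units. If \<open>n\<close> divides \<open>m\<close>, adding \<open>n\<int>\<close> to the coset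
  of \<open>k\<close> modulo \<open>m\<close> yields the coset of \<open>k\<close> modulo \<open>n\<close>.
\<close>

definition ZFact_proj :: "int \<Rightarrow> int set \<Rightarrow> int set"
  where "ZFact_proj n C = C <+>\<^bsub>\<Z>\<^esub> (Idl\<^bsub>\<Z>\<^esub> {n})"

definition poly_of_int_poly :: "int \<Rightarrow> ('x list \<Rightarrow> int) \<Rightarrow> 'x list \<Rightarrow> int set"
  where "poly_of_int_poly m f = (\<lambda>w. ZMod m (f w))"

definition poly_proj :: "int \<Rightarrow> ('x list \<Rightarrow> int set) \<Rightarrow> 'x list \<Rightarrow> int set"
  where "poly_proj n f = (\<lambda>w. ZFact_proj n (f w))"


section \<open>Overlap relations\<close>

definition overlap :: "'x set \<Rightarrow> 'x list \<Rightarrow> 'x list \<Rightarrow> 'x list \<times> 'x list \<Rightarrow> 'x list \<times> 'x list \<Rightarrow> bool"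
  where "overlap X p q \<tau> \<tau>' \<longleftrightarrow>
    act_word \<tau> p = act_word \<tau>' q \<and>
    (\<exists>x \<in> lists X. \<exists>x' \<in> lists X. \<exists>y \<in> lists X. \<exists>y' \<in> lists X.
      \<tau> = ([], x') \<and> \<tau>' = (y, []) \<or>
      \<tau> = (x, []) \<and> \<tau>' = ([], y') \<or>
      \<tau> = ([], []) \<and> \<tau>' = (y, y') \<or>
      \<tau> = (x, x') \<and> \<tau>' = ([], []))"

definition overlap_poly :: "int \<Rightarrow> int \<Rightarrow> int \<Rightarrow> int \<Rightarrow> int \<Rightarrow> 'x set \<Rightarrow> 'x list rel \<Rightarrow>
    ('x list \<Rightarrow> int set) \<Rightarrow> ('x list \<Rightarrow> int set) \<Rightarrow>
    'x list \<times> 'x list \<Rightarrow> 'x list \<times> 'x list \<Rightarrow> 'x list \<Rightarrow> int set"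
  where "overlap_poly m a b r s X ord g h \<tau> \<tau>' =
    (ZMod m (a * r) \<otimes>\<^bsub>ZFact m\<^esub> lc (ZFact m) ord g) \<odot>\<^bsub>free_alg (ZFact m) X\<^esub> act (ZFact m) X \<tau>' h
    \<oplus>\<^bsub>free_alg (ZFact m) X\<^esub>
    (ZMod m (b * s) \<otimes>\<^bsub>ZFact m\<^esub> lc (ZFact m) ord h) \<odot>\<^bsub>free_alg (ZFact m) X\<^esub> act (ZFact m) X \<tau> g"


section \<open>Well-definedness\<close>

lemma (in abelian_monoid) finsum_Sigma':
  assumes "finite A" "\<And>x. x \<in> A \<Longrightarrow> finite (B x)"
    and "\<And>x y. x \<in> A \<Longrightarrow> y \<in> B x \<Longrightarrow> f (x, y) \<in> carrier G"
  shows "(\<Oplus>x\<in>A. \<Oplus>y\<in>B x. f (x, y)) = finsum G f (Sigma A B)"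
  using assms
proof (induction A rule: finite_induct)
  case empty
  then show ?case by simp
next
  case (insert a A)
  have S: "Sigma (insert a A) B = Pair a ` B a \<union> Sigma A B" by auto
  have "finsum G f (Pair a ` B a) = (\<Oplus>y\<in>B a. f (a, y))"
    by (rule finsum_reindex) (use insert.prems in \<open>auto simp: inj_on_def\<close>)
  moreover have "finsum G f (Pair a ` B a \<union> Sigma A B)
      = finsum G f (Pair a ` B a) \<oplus> finsum G f (Sigma A B)"
    by (rule finsum_Un_disjoint) (use insert in auto)
  moreover have "(\<Oplus>x\<in>insert a A. \<Oplus>y\<in>B x. f (x, y))
      = (\<Oplus>y\<in>B a. f (a, y)) \<oplus> (\<Oplus>x\<in>A. \<Oplus>y\<in>B x. f (x, y))"
    by (rule finsum_insert) (use insert in \<open>auto intro!: finsum_closed\<close>)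
  ultimately show ?case
    unfolding S using insert by auto
qed

lemma finite_splits: "finite {p. fst p @ snd p = w}"
proof (rule finite_subset)
  have "p \<in> (\<lambda>i. (take i w, drop i w)) ` {..length w}" if "fst p @ snd p = w" for p
    by (rule image_eqI[where x = "length (fst p)"]) (use that in \<open>auto simp: prod_eq_iff\<close>)
  then show "{p. fst p @ snd p = w} \<subseteq> (\<lambda>i. (take i w, drop i w)) ` {..length w}"
    by blast
qed simp

lemma (in ring) free_alg_mult_closed:
  assumes "f \<in> carrier (free_alg R X)" "g \<in> carrier (free_alg R X)"
  shows "f \<otimes>\<^bsub>free_alg R X\<^esub> g \<in> carrier (free_alg R X)"
proof -
  let ?h = "\<lambda>w. \<Oplus>p \<in> {p. fst p @ snd p = w}. f (fst p) \<otimes> g (snd p)"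
  let ?F = "{w. f w \<noteq> \<zero>}" and ?G = "{w. g w \<noteq> \<zero>}"
  have c: "f w \<in> carrier R" "g w \<in> carrier R" for w
    using assms by (auto simp: free_alg_def)
  have "?h w \<in> carrier R" for w
    by (rule finsum_closed) (auto simp: c)
  moreover have sub: "{w. ?h w \<noteq> \<zero>} \<subseteq> (\<lambda>(u, v). u @ v) ` (?F \<times> ?G)"
  proof (rule subsetI, rule ccontr)
    fix w assume w: "w \<in> {w. ?h w \<noteq> \<zero>}" "w \<notin> (\<lambda>(u, v). u @ v) ` (?F \<times> ?G)"
    have "?h w = (\<Oplus>p \<in> {p. fst p @ snd p = w}. \<zero>)"
    proof (rule add.finprod_cong')
      fix p assume "p \<in> {p. fst p @ snd p = w}"
      with w(2) have "f (fst p) = \<zero> \<or> g (snd p) = \<zero>" by (force simp: image_iff)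
      then show "(f (fst p) \<otimes> g (snd p)) = \<zero>"
        using c by (auto simp: split_beta)
    qed auto
    with w(1) show False by (simp add: add.finprod_one_eqI)
  qed
  moreover have "(\<lambda>(u, v). u @ v) ` (?F \<times> ?G) \<subseteq> lists X"
    using assms by (fastforce simp: free_alg_def)
  moreover have "finite ((\<lambda>(u, v). u @ v) ` (?F \<times> ?G))"
    using assms by (auto simp: free_alg_def)
  ultimately have "\<forall>w. ?h w \<in> carrier R" "{w. ?h w \<noteq> \<zero>} \<subseteq> lists X" "finite {w. ?h w \<noteq> \<zero>}"
    by (blast, meson order_trans, meson finite_subset)
  then show ?thesis
    unfolding free_alg_def by simp
qed

lemma (in ring) free_alg_mult_assoc:
  fixes X :: "'x set"
  assumes "f \<in> carrier (free_alg R X)" "g \<in> carrier (free_alg R X)" "h \<in> carrier (free_alg R X)"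
  shows "(f \<otimes>\<^bsub>free_alg R X\<^esub> g) \<otimes>\<^bsub>free_alg R X\<^esub> h = f \<otimes>\<^bsub>free_alg R X\<^esub> (g \<otimes>\<^bsub>free_alg R X\<^esub> h)"
proof
  fix w :: "'x list"
  let ?D = "\<lambda>w. {p :: 'x list \<times> 'x list. fst p @ snd p = w}"
  have c: "f w \<in> carrier R" "g w \<in> carrier R" "h w \<in> carrier R" for w
    using assms by (auto simp: free_alg_def)
  let ?t = "\<lambda>(u, v, z). f u \<otimes> (g v \<otimes> h z)"
  let ?T = "{(u, v, z). u @ v @ z = w}"
  have "((f \<otimes>\<^bsub>free_alg R X\<^esub> g) \<otimes>\<^bsub>free_alg R X\<^esub> h) w
      = (\<Oplus>p\<in>?D w. (\<Oplus>q\<in>?D (fst p). f (fst q) \<otimes> g (snd q)) \<otimes> h (snd p))"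
    by (simp add: free_alg_def split_beta)
  also have "\<dots> = (\<Oplus>p\<in>?D w. \<Oplus>q\<in>?D (fst p). ?t (fst q, snd q, snd p))"
  proof (rule add.finprod_cong', goal_cases)
    case (3 p)
    have "(\<Oplus>q\<in>?D (fst p). f (fst q) \<otimes> g (snd q)) \<otimes> h (snd p)
        = (\<Oplus>q\<in>?D (fst p). (f (fst q) \<otimes> g (snd q)) \<otimes> h (snd p))"
      by (rule finsum_ldistr) (auto simp: c finite_splits)
    also have "\<dots> = (\<Oplus>q\<in>?D (fst p). ?t (fst q, snd q, snd p))"
      by (rule add.finprod_cong') (auto simp: c m_assoc)
    finally show ?case .
  qed (auto intro!: finsum_closed simp: c)
  also have "\<dots> = finsum R (\<lambda>x. ?t (fst (snd x), snd (snd x), snd (fst x))) (Sigma (?D w) (\<lambda>p. ?D (fst p)))"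
    by (subst finsum_Sigma'[symmetric]) (auto simp: c finite_splits)
  also have "\<dots> = finsum R ?t ((\<lambda>x. (fst (snd x), snd (snd x), snd (fst x))) ` Sigma (?D w) (\<lambda>p. ?D (fst p)))"
    by (rule finsum_reindex[symmetric]) (auto simp: c inj_on_def)
  also have "(\<lambda>x. (fst (snd x), snd (snd x), snd (fst x))) ` Sigma (?D w) (\<lambda>p. ?D (fst p)) = ?T"
    by (force simp: image_iff)
  finally have 1: "((f \<otimes>\<^bsub>free_alg R X\<^esub> g) \<otimes>\<^bsub>free_alg R X\<^esub> h) w = finsum R ?t ?T" .
  have "(f \<otimes>\<^bsub>free_alg R X\<^esub> (g \<otimes>\<^bsub>free_alg R X\<^esub> h)) w
      = (\<Oplus>p\<in>?D w. f (fst p) \<otimes> (\<Oplus>q\<in>?D (snd p). g (fst q) \<otimes> h (snd q)))"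
    by (simp add: free_alg_def split_beta)
  also have "\<dots> = (\<Oplus>p\<in>?D w. \<Oplus>q\<in>?D (snd p). ?t (fst p, fst q, snd q))"
  proof (rule add.finprod_cong', goal_cases)
    case (3 p)
    have "f (fst p) \<otimes> (\<Oplus>q\<in>?D (snd p). g (fst q) \<otimes> h (snd q))
        = (\<Oplus>q\<in>?D (snd p). f (fst p) \<otimes> (g (fst q) \<otimes> h (snd q)))"
      by (rule finsum_rdistr) (auto simp: c finite_splits)
    also have "\<dots> = (\<Oplus>q\<in>?D (snd p). ?t (fst p, fst q, snd q))"
      by (rule add.finprod_cong') (auto simp: c)
    finally show ?case .
  qed (auto intro!: finsum_closed simp: c)
  also have "\<dots> = finsum R (\<lambda>x. ?t (fst (fst x), fst (snd x), snd (snd x))) (Sigma (?D w) (\<lambda>p. ?D (snd p)))"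
    by (subst finsum_Sigma'[symmetric]) (auto simp: c finite_splits)
  also have "\<dots> = finsum R ?t ((\<lambda>x. (fst (fst x), fst (snd x), snd (snd x))) ` Sigma (?D w) (\<lambda>p. ?D (snd p)))"
    by (rule finsum_reindex[symmetric]) (auto simp: c inj_on_def)
  also have "(\<lambda>x. (fst (fst x), fst (snd x), snd (snd x))) ` Sigma (?D w) (\<lambda>p. ?D (snd p)) = ?T"
    by (force simp: image_iff)
  finally show "((f \<otimes>\<^bsub>free_alg R X\<^esub> g) \<otimes>\<^bsub>free_alg R X\<^esub> h) w = (f \<otimes>\<^bsub>free_alg R X\<^esub> (g \<otimes>\<^bsub>free_alg R X\<^esub> h)) w"
    using 1 by simp
qed

lemma (in ring) free_alg_one:
  fixes X :: "'x set"
  assumes "f \<in> carrier (free_alg R X)"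
  shows "\<one>\<^bsub>free_alg R X\<^esub> \<otimes>\<^bsub>free_alg R X\<^esub> f = f" "f \<otimes>\<^bsub>free_alg R X\<^esub> \<one>\<^bsub>free_alg R X\<^esub> = f"
proof -
  have c: "f w \<in> carrier R" for w
    using assms by (auto simp: free_alg_def)
  have "(\<Oplus>p \<in> {p. fst p @ snd p = w}. (if fst p = [] then \<one> else \<zero>) \<otimes> f (snd p)) = f w" for w
  proof -
    have "(\<Oplus>p \<in> {p. fst p @ snd p = w}. (if fst p = [] then \<one> else \<zero>) \<otimes> f (snd p))
        = (\<Oplus>p \<in> {p. fst p @ snd p = w}. if ([], w) = p then f (snd p) else \<zero>)"
      by (rule add.finprod_cong') (auto simp: c)
    also have "\<dots> = f (snd ([] :: 'x list, w))"
      by (rule add.finprod_singleton[where f = "\<lambda>p. f (snd p)"]) (auto simp: c finite_splits)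
    finally show ?thesis by simp
  qed
  then show "\<one>\<^bsub>free_alg R X\<^esub> \<otimes>\<^bsub>free_alg R X\<^esub> f = f"
    by (simp add: free_alg_def)
  have "(\<Oplus>p \<in> {p. fst p @ snd p = w}. f (fst p) \<otimes> (if snd p = [] then \<one> else \<zero>)) = f w" for w
  proof -
    have "(\<Oplus>p \<in> {p. fst p @ snd p = w}. f (fst p) \<otimes> (if snd p = [] then \<one> else \<zero>))
        = (\<Oplus>p \<in> {p. fst p @ snd p = w}. if (w, []) = p then f (fst p) else \<zero>)"
      by (rule add.finprod_cong') (auto simp: c)
    also have "\<dots> = f (fst (w, [] :: 'x list))"
      by (rule add.finprod_singleton[where f = "\<lambda>p. f (fst p)"]) (auto simp: c finite_splits)
    finally show ?thesis by simp
  qed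
  then show "f \<otimes>\<^bsub>free_alg R X\<^esub> \<one>\<^bsub>free_alg R X\<^esub> = f"
    by (simp add: free_alg_def)
qed

theorem (in ring) free_alg_is_ring: "ring (free_alg R X)"
proof (rule ringI)
  show "abelian_group (free_alg R X)"
  proof (rule abelian_groupI, goal_cases)
    case (1 f g)
    have "{w. f w \<oplus> g w \<noteq> \<zero>} \<subseteq> {w. f w \<noteq> \<zero>} \<union> {w. g w \<noteq> \<zero>}" by auto
    moreover have "{w. f w \<noteq> \<zero>} \<union> {w. g w \<noteq> \<zero>} \<subseteq> lists X"
      and "finite ({w. f w \<noteq> \<zero>} \<union> {w. g w \<noteq> \<zero>})"
      using 1 unfolding free_alg_def by auto
    ultimately have "{w. f w \<oplus> g w \<noteq> \<zero>} \<subseteq> lists X" "finite {w. f w \<oplus> g w \<noteq> \<zero>}"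
      by (blast, metis finite_subset)
    then show ?case
      using 1 unfolding free_alg_def by simp
  next
    case (6 f)
    then have c: "f w \<in> carrier R" for w by (auto simp: free_alg_def)
    have "{w. \<ominus> f w \<noteq> \<zero>} \<subseteq> {w. f w \<noteq> \<zero>}" by auto
    moreover have "{w. f w \<noteq> \<zero>} \<subseteq> lists X" "finite {w. f w \<noteq> \<zero>}"
      using 6 unfolding free_alg_def by auto
    ultimately have "{w. \<ominus> f w \<noteq> \<zero>} \<subseteq> lists X" "finite {w. \<ominus> f w \<noteq> \<zero>}"
      by (blast, metis finite_subset)
    then show ?case
      using c by (intro bexI[where x = "\<lambda>w. \<ominus> f w"]) (auto simp: free_alg_def l_neg)
  qed (auto simp: free_alg_def a_ac)
  show "Group.monoid (free_alg R X)"
    by (rule monoidI)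
      (auto intro: free_alg_mult_closed free_alg_mult_assoc free_alg_one,
       auto simp: free_alg_def)
next
  fix f g h
  assume A: "f \<in> carrier (free_alg R X)" "g \<in> carrier (free_alg R X)" "h \<in> carrier (free_alg R X)"
  then have c: "f w \<in> carrier R" "g w \<in> carrier R" "h w \<in> carrier R" for w
    by (auto simp: free_alg_def)
  have "(\<Oplus>p \<in> {p. fst p @ snd p = w}. (f (fst p) \<oplus> g (fst p)) \<otimes> h (snd p))
      = (\<Oplus>p \<in> {p. fst p @ snd p = w}. (f (fst p) \<otimes> h (snd p)) \<oplus> (g (fst p) \<otimes> h (snd p)))" for w
    by (rule add.finprod_cong') (auto simp: c l_distr)
  also have "\<dots> w = (\<Oplus>p \<in> {p. fst p @ snd p = w}. f (fst p) \<otimes> h (snd p))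
      \<oplus> (\<Oplus>p \<in> {p. fst p @ snd p = w}. g (fst p) \<otimes> h (snd p))" for w
    by (rule finsum_addf) (auto simp: c)
  finally show "(f \<oplus>\<^bsub>free_alg R X\<^esub> g) \<otimes>\<^bsub>free_alg R X\<^esub> h
      = f \<otimes>\<^bsub>free_alg R X\<^esub> h \<oplus>\<^bsub>free_alg R X\<^esub> g \<otimes>\<^bsub>free_alg R X\<^esub> h"
    by (simp add: free_alg_def)
  have "(\<Oplus>p \<in> {p. fst p @ snd p = w}. h (fst p) \<otimes> (f (snd p) \<oplus> g (snd p)))
      = (\<Oplus>p \<in> {p. fst p @ snd p = w}. (h (fst p) \<otimes> f (snd p)) \<oplus> (h (fst p) \<otimes> g (snd p)))" for w
    by (rule add.finprod_cong') (auto simp: c r_distr)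
  also have "\<dots> w = (\<Oplus>p \<in> {p. fst p @ snd p = w}. h (fst p) \<otimes> f (snd p))
      \<oplus> (\<Oplus>p \<in> {p. fst p @ snd p = w}. h (fst p) \<otimes> g (snd p))" for w
    by (rule finsum_addf) (auto simp: c)
  finally show "h \<otimes>\<^bsub>free_alg R X\<^esub> (f \<oplus>\<^bsub>free_alg R X\<^esub> g)
      = h \<otimes>\<^bsub>free_alg R X\<^esub> f \<oplus>\<^bsub>free_alg R X\<^esub> h \<otimes>\<^bsub>free_alg R X\<^esub> g"
    by (simp add: free_alg_def)
qed

lemma ZMod_eq: "ZMod j k = range (\<lambda>x. x * j + k)"
  by (auto simp: ZMod_def a_r_coset_def' int_Idl)

lemma ZFact_proj_ZMod:
  assumes "n dvd m"
  shows "ZFact_proj n (ZMod m k) = ZMod n k"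
proof -
  from assms obtain d where m: "m = n * d" ..
  have "x * m + k + y * n = (x * d + y) * n + k" "x * n + k = 0 * m + k + x * n" for x y
    by (simp_all add: m algebra_simps)
  then have "{z. \<exists>x y. z = x * m + k + y * n} = {z. \<exists>x. z = x * n + k}"
    by metis
  moreover have "ZFact_proj n (ZMod m k) = {z. \<exists>x y. z = x * m + k + y * n}"
    unfolding ZFact_proj_def ZMod_eq set_add_def' int_Idl by auto
  moreover have "ZMod n k = {z. \<exists>x. z = x * n + k}"
    unfolding ZMod_eq by auto
  ultimately show ?thesis
    by (simp only:)
qed

end

theory Submission
  imports Defs
begin

text \<open>
  Since \<open>a\<close> and \<open>b\<close> are coprime, \<open>\<int>/m\<close> is the product of \<open>\<int>/a\<close> and \<open>\<int>/b\<close>, and the Bezout identity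
  \<open>a r + b s = 1\<close> splits the unit into the idempotent \<open>a r\<close>, which vanishes modulo \<open>a\<close> and is \<open>1\<close> modulo
  \<open>b\<close>, and the idempotent \<open>b s\<close>, which does the opposite. The theorem glues the two given bases along
  this decomposition.

  \<^item> The overlap polynomials belong to \<open>J\<close>. An element \<open>g\<close> of the first basis agrees modulo \<open>a\<close> with
    some \<open>j \<in> J\<close>, and the factor \<open>b s\<close> kills multiples of \<open>a\<close>; so \<open>b s g = b s j\<close> lies in \<open>J\<close>. The other
    summand is symmetric (\<open>smult_act_annihilator_in_ideal\<close>, \<open>overlap_poly_in_ideal\<close>).

  \<^item> Leading terms multiply. At the common word of an overlap relation, the two summands
    contribute \<open>a r \<cdot> lc g \<cdot> lc h\<close> and \<open>b s \<cdot> lc h \<cdot> lc g\<close>, which add up to \<open>lc g \<cdot> lc h\<close>; all other words of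
    either summand are smaller. Thus the common word is the leading monomial unless \<open>lc g \<cdot> lc h = 0\<close>
    (\<open>lt_overlap_poly\<close>).

  \<^item> Every leading term of \<open>J\<close> is divided by one of these. Let \<open>c u\<close> be the leading term of a nonzero
    \<open>f \<in> J\<close>. If \<open>c\<close> survives modulo \<open>a\<close>, the first basis yields a \<open>g\<close> whose leading term divides \<open>c u\<close> modulo
    \<open>a\<close>; otherwise the constant \<open>a\<close> itself will do. In both cases the divisibility hypotheses on
    leading coefficients make \<open>lc g\<close> a unit modulo \<open>b\<close> (\<open>lift_strong_groebner_divisor\<close>). Together with
    the symmetric choice of \<open>h\<close>, the product \<open>lc g \<cdot> lc h\<close> divides \<open>c\<close> modulo \<open>a\<close> and modulo \<open>b\<close>, hence
    modulo \<open>m\<close> (\<open>gcd_mult_dvd_of_coprime\<close>); in particular it is nonzero. Both leading monomials occur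
    in \<open>u\<close>, and the smallest stretch of \<open>u\<close> that covers the two occurrences is an overlap
    (\<open>word_divides_overlap\<close>).

  Divisibility of all leading terms already implies the inclusion of the ideals that they generate
  (\<open>strong_groebner_basisI\<close>).
\<close>


section \<open>Multiplication by terms\<close>

lemma free_alg_simps:
  "\<zero>\<^bsub>free_alg R X\<^esub> = (\<lambda>w. \<zero>\<^bsub>R\<^esub>)"
  "f \<oplus>\<^bsub>free_alg R X\<^esub> g = (\<lambda>w. f w \<oplus>\<^bsub>R\<^esub> g w)"
  "c \<odot>\<^bsub>free_alg R X\<^esub> f = (\<lambda>w. c \<otimes>\<^bsub>R\<^esub> f w)"
  by (simp_all add: free_alg_def)

lemma free_alg_coeff_closed: "f \<in> carrier (free_alg R X) \<Longrightarrow> f w \<in> carrier R"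
  by (auto simp: free_alg_def)

lemma (in ring) fa_term_closed:
  "c \<in> carrier R \<Longrightarrow> u \<in> lists X \<Longrightarrow> fa_term R c u \<in> carrier (free_alg R X)"
  by (auto simp: free_alg_def fa_term_def)

text \<open>
  In a product with a term, at most one factorization of a given word contributes to the convolution,
  because the other factor is determined by cancellation.
\<close>

lemma (in ring) fa_term_mult_left:
  fixes f :: "'x list \<Rightarrow> 'a"
  assumes "c \<in> carrier R" "f \<in> carrier (free_alg R X)"
  shows "(fa_term R c u \<otimes>\<^bsub>free_alg R X\<^esub> f) (u @ v) = c \<otimes> f v"
    and "w \<notin> range (\<lambda>v. u @ v) \<Longrightarrow> (fa_term R c u \<otimes>\<^bsub>free_alg R X\<^esub> f) w = \<zero>"
proof -
  let ?D = "\<lambda>w. {p :: 'x list \<times> 'x list. fst p @ snd p = w}"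
  note cl = assms(1) free_alg_coeff_closed[OF assms(2)]
  have "(fa_term R c u \<otimes>\<^bsub>free_alg R X\<^esub> f) (u @ v)
      = (\<Oplus>p \<in> ?D (u @ v). if (u, v) = p then c \<otimes> f (snd p) else \<zero>)"
    unfolding free_alg_def fa_term_def
    by (simp, rule add.finprod_cong') (auto simp: cl)
  also have "\<dots> = c \<otimes> f (snd (u, v))"
    by (rule add.finprod_singleton[where f = "\<lambda>p. c \<otimes> f (snd p)"]) (auto simp: cl finite_splits)
  finally show "(fa_term R c u \<otimes>\<^bsub>free_alg R X\<^esub> f) (u @ v) = c \<otimes> f v" by simp
  assume w: "w \<notin> range (\<lambda>v. u @ v)"
  show "(fa_term R c u \<otimes>\<^bsub>free_alg R X\<^esub> f) w = \<zero>"
    unfolding free_alg_def fa_term_def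
    by (simp, rule add.finprod_one_eqI) (use w in \<open>auto simp: cl\<close>)
qed

lemma (in ring) fa_term_mult_right:
  fixes f :: "'x list \<Rightarrow> 'a"
  assumes "c \<in> carrier R" "f \<in> carrier (free_alg R X)"
  shows "(f \<otimes>\<^bsub>free_alg R X\<^esub> fa_term R c v) (u @ v) = f u \<otimes> c"
    and "w \<notin> range (\<lambda>u. u @ v) \<Longrightarrow> (f \<otimes>\<^bsub>free_alg R X\<^esub> fa_term R c v) w = \<zero>"
proof -
  let ?D = "\<lambda>w. {p :: 'x list \<times> 'x list. fst p @ snd p = w}"
  note cl = assms(1) free_alg_coeff_closed[OF assms(2)]
  have "(f \<otimes>\<^bsub>free_alg R X\<^esub> fa_term R c v) (u @ v)
      = (\<Oplus>p \<in> ?D (u @ v). if (u, v) = p then f (fst p) \<otimes> c else \<zero>)"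
    unfolding free_alg_def fa_term_def
    by (simp, rule add.finprod_cong') (auto simp: cl)
  also have "\<dots> = f (fst (u, v)) \<otimes> c"
    by (rule add.finprod_singleton[where f = "\<lambda>p. f (fst p) \<otimes> c"]) (auto simp: cl finite_splits)
  finally show "(f \<otimes>\<^bsub>free_alg R X\<^esub> fa_term R c v) (u @ v) = f u \<otimes> c" by simp
  assume w: "w \<notin> range (\<lambda>u. u @ v)"
  show "(f \<otimes>\<^bsub>free_alg R X\<^esub> fa_term R c v) w = \<zero>"
    unfolding free_alg_def fa_term_def
    by (simp, rule add.finprod_one_eqI) (use w in \<open>auto simp: cl\<close>)
qed

lemma (in ring) fa_term_mult_both:
  fixes f :: "'x list \<Rightarrow> 'a"
  assumes "c \<in> carrier R" "f \<in> carrier (free_alg R X)" "fst \<tau> \<in> lists X"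
  shows "(fa_term R c (fst \<tau>) \<otimes>\<^bsub>free_alg R X\<^esub> f \<otimes>\<^bsub>free_alg R X\<^esub> fa_term R \<one> (snd \<tau>)) (act_word \<tau> v)
      = c \<otimes> f v"
    and "w \<notin> range (act_word \<tau>) \<Longrightarrow>
      (fa_term R c (fst \<tau>) \<otimes>\<^bsub>free_alg R X\<^esub> f \<otimes>\<^bsub>free_alg R X\<^esub> fa_term R \<one> (snd \<tau>)) w = \<zero>"
proof -
  let ?p = "fa_term R c (fst \<tau>) \<otimes>\<^bsub>free_alg R X\<^esub> f"
  have p: "?p \<in> carrier (free_alg R X)"
    using assms by (intro free_alg_mult_closed fa_term_closed)
  note cl = assms(1) free_alg_coeff_closed[OF assms(2)]
  show "(?p \<otimes>\<^bsub>free_alg R X\<^esub> fa_term R \<one> (snd \<tau>)) (act_word \<tau> v) = c \<otimes> f v"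
    using fa_term_mult_right(1)[OF one_closed p, of "snd \<tau>" "fst \<tau> @ v"]
      fa_term_mult_left(1)[OF assms(1,2), of "fst \<tau>" v]
    by (simp add: act_word_def cl)
  assume w: "w \<notin> range (act_word \<tau>)"
  show "(?p \<otimes>\<^bsub>free_alg R X\<^esub> fa_term R \<one> (snd \<tau>)) w = \<zero>"
  proof (cases "w \<in> range (\<lambda>u. u @ snd \<tau>)")
    case True
    then obtain u where u: "w = u @ snd \<tau>" by auto
    with w have "u \<notin> range (\<lambda>v. fst \<tau> @ v)" by (auto simp: act_word_def)
    then show ?thesis
      unfolding u fa_term_mult_right(1)[OF one_closed p]
      using fa_term_mult_left(2)[OF assms(1,2)] by simp
  qed (rule fa_term_mult_right(2)[OF one_closed p])
qed

lemma inj_act_word: "inj (act_word \<tau>)"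
  by (auto simp: inj_def act_word_def)

lemma (in ring) act_coeff:
  assumes "f \<in> carrier (free_alg R X)" "\<tau> \<in> env_basis X"
  shows "act R X \<tau> f (act_word \<tau> v) = f v"
    and "w \<notin> range (act_word \<tau>) \<Longrightarrow> act R X \<tau> f w = \<zero>"
proof -
  have "fst \<tau> \<in> lists X" using assms(2) by (simp add: env_basis_def mem_Times_iff)
  note both = fa_term_mult_both[OF one_closed assms(1) this]
  show "act R X \<tau> f (act_word \<tau> v) = f v"
    unfolding act_def both(1) using free_alg_coeff_closed[OF assms(1)] by simp
  show "w \<notin> range (act_word \<tau>) \<Longrightarrow> act R X \<tau> f w = \<zero>"
    unfolding act_def by (rule both(2))
qed

text \<open>A scalar can be absorbed into the left term, so that ideals are closed under scaled actions.\<close>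

lemma (in ring) smult_act:
  assumes "c \<in> carrier R" "f \<in> carrier (free_alg R X)" "\<tau> \<in> env_basis X"
  shows "c \<odot>\<^bsub>free_alg R X\<^esub> act R X \<tau> f
    = fa_term R c (fst \<tau>) \<otimes>\<^bsub>free_alg R X\<^esub> f \<otimes>\<^bsub>free_alg R X\<^esub> fa_term R \<one> (snd \<tau>)"
proof
  fix w
  have \<tau>: "fst \<tau> \<in> lists X" using assms(3) by (auto simp: env_basis_def)
  show "(c \<odot>\<^bsub>free_alg R X\<^esub> act R X \<tau> f) w
    = (fa_term R c (fst \<tau>) \<otimes>\<^bsub>free_alg R X\<^esub> f \<otimes>\<^bsub>free_alg R X\<^esub> fa_term R \<one> (snd \<tau>)) w"
    by (cases "w \<in> range (act_word \<tau>)")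
      (auto simp: free_alg_simps act_coeff[OF assms(2,3)] fa_term_mult_both[OF assms(1,2) \<tau>] assms(1))
qed

lemma (in ring) smult_act_in_ideal:
  assumes "ideal J (free_alg R X)" "f \<in> J" "c \<in> carrier R" "\<tau> \<in> env_basis X"
  shows "c \<odot>\<^bsub>free_alg R X\<^esub> act R X \<tau> f \<in> J"
proof -
  interpret J: ideal J "free_alg R X" by fact
  have "f \<in> carrier (free_alg R X)" using J.a_subset assms(2) by blast
  then show ?thesis
    unfolding smult_act[OF assms(3) _ assms(4)]
    using J.I_r_closed[OF J.I_l_closed[OF assms(2) fa_term_closed[OF assms(3)]]
        fa_term_closed[OF one_closed], of "fst \<tau>" "snd \<tau>"] assms(4)
    by (simp add: smult_act[OF assms(3) _ assms(4)] env_basis_def mem_Times_iff)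
qed

lemma (in ring) smult_act_fa_term:
  fixes u :: "'x list"
  assumes "c \<in> carrier R" "d \<in> carrier R" "u \<in> lists X" "\<tau> \<in> env_basis X"
  shows "d \<odot>\<^bsub>free_alg R X\<^esub> act R X \<tau> (fa_term R c u) = fa_term R (d \<otimes> c) (act_word \<tau> u)"
proof
  fix w
  have t: "fa_term R c u \<in> carrier (free_alg R X)" by (rule fa_term_closed) fact+
  have coeff: "fa_term R e v x = (if x = v then e else \<zero>)" for e and v x :: "'x list"
    by (simp add: fa_term_def)
  show "(d \<odot>\<^bsub>free_alg R X\<^esub> act R X \<tau> (fa_term R c u)) w = fa_term R (d \<otimes> c) (act_word \<tau> u) w"
    by (cases "w \<in> range (act_word \<tau>)")
      (auto simp: free_alg_simps act_coeff[OF t assms(4)] coeff assms(1,2)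
          inj_eq[OF inj_act_word])
qed


section \<open>Leading monomials\<close>

lemma monomial_well_orderD:
  assumes "monomial_well_order X ord"
  shows "(u, v) \<in> ord \<Longrightarrow> u \<in> lists X \<and> v \<in> lists X"
    and "(u, v) \<in> ord \<Longrightarrow> (v, u) \<in> ord \<Longrightarrow> u = v"
    and "(u, v) \<in> ord \<Longrightarrow> (v, w) \<in> ord \<Longrightarrow> (u, w) \<in> ord"
    and "u \<in> lists X \<Longrightarrow> v \<in> lists X \<Longrightarrow> (u, v) \<in> ord \<or> (v, u) \<in> ord"
    and "(u, v) \<in> ord \<Longrightarrow> \<tau> \<in> env_basis X \<Longrightarrow> (act_word \<tau> u, act_word \<tau> v) \<in> ord"
proof -
  have lin: "ord \<subseteq> lists X \<times> lists X" "antisym ord" "trans ord" "total_on (lists X) ord"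
      "refl_on (lists X) ord"
    and mono: "\<forall>u \<in> lists X. \<forall>v \<in> lists X. \<forall>p \<in> lists X. \<forall>q \<in> lists X.
      (u, v) \<in> ord \<longrightarrow> (p @ u @ q, p @ v @ q) \<in> ord"
    using assms unfolding monomial_well_order_def order_on_defs by blast+
  show *: "(u, v) \<in> ord \<Longrightarrow> u \<in> lists X \<and> v \<in> lists X" using lin(1) by blast
  show "(u, v) \<in> ord \<Longrightarrow> (v, u) \<in> ord \<Longrightarrow> u = v" using lin(2) by (auto dest: antisymD)
  show "(u, v) \<in> ord \<Longrightarrow> (v, w) \<in> ord \<Longrightarrow> (u, w) \<in> ord" using lin(3) by (auto dest: transD)
  show "u \<in> lists X \<Longrightarrow> v \<in> lists X \<Longrightarrow> (u, v) \<in> ord \<or> (v, u) \<in> ord"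
    using lin(4,5) by (metis refl_onD total_on_def)
  show "(u, v) \<in> ord \<Longrightarrow> \<tau> \<in> env_basis X \<Longrightarrow> (act_word \<tau> u, act_word \<tau> v) \<in> ord"
    using mono * unfolding act_word_def env_basis_def by (metis mem_Times_iff)
qed

lemma lm_eqI:
  assumes "monomial_well_order X ord"
    and "f w \<noteq> \<zero>\<^bsub>R\<^esub>" "\<And>v. f v \<noteq> \<zero>\<^bsub>R\<^esub> \<Longrightarrow> (v, w) \<in> ord"
  shows "lm R ord f = w"
  unfolding lm_def
  by (rule the_equality) (use assms monomial_well_orderD(2)[OF assms(1)] in auto)

text \<open>
  The leading monomial is a definite description. It denotes the largest word of the support, which
  exists since the support of a nonzero polynomial is finite and nonempty.
\<close>

lemma lm_props:
  assumes "monomial_well_order X ord"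
    and "f \<in> carrier (free_alg R X)" "f \<noteq> \<zero>\<^bsub>free_alg R X\<^esub>"
  shows lm_coeff_nonzero: "f (lm R ord f) \<noteq> \<zero>\<^bsub>R\<^esub>"
    and lm_max: "\<And>v. f v \<noteq> \<zero>\<^bsub>R\<^esub> \<Longrightarrow> (v, lm R ord f) \<in> ord"
    and lm_in_lists: "lm R ord f \<in> lists X"
proof -
  note O = monomial_well_orderD[OF assms(1)]
  have max: "\<exists>w\<in>S. \<forall>v\<in>S. (v, w) \<in> ord" if "finite S" "S \<noteq> {}" "S \<subseteq> lists X" for S
    using that
  proof (induction S rule: finite_ne_induct)
    case (singleton x)
    then show ?case using O(4)[of x x] by auto
  next
    case (insert x S)
    then obtain w where w: "w \<in> S" "\<forall>v\<in>S. (v, w) \<in> ord" by auto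
    have xw: "x \<in> lists X" "w \<in> lists X" using insert.prems w(1) by auto
    show ?case
    proof (cases "(x, w) \<in> ord")
      case True
      then show ?thesis using w by auto
    next
      case False
      then have "(w, x) \<in> ord" using O(4) xw by blast
      then have "\<forall>v\<in>insert x S. (v, x) \<in> ord" using w(2) O(3) O(4)[of x x] xw(1) by blast
      then show ?thesis by blast
    qed
  qed
  let ?S = "{w. f w \<noteq> \<zero>\<^bsub>R\<^esub>}"
  have "finite ?S" "?S \<subseteq> lists X" "?S \<noteq> {}"
    using assms(2,3) by (auto simp: free_alg_def)
  from max[OF this(1,3,2)] obtain w where w: "f w \<noteq> \<zero>\<^bsub>R\<^esub>" "\<And>v. f v \<noteq> \<zero>\<^bsub>R\<^esub> \<Longrightarrow> (v, w) \<in> ord"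
    by auto
  have "lm R ord f = w" by (rule lm_eqI[OF assms(1)]) (use w in auto)
  then show "f (lm R ord f) \<noteq> \<zero>\<^bsub>R\<^esub>" "\<And>v. f v \<noteq> \<zero>\<^bsub>R\<^esub> \<Longrightarrow> (v, lm R ord f) \<in> ord"
    "lm R ord f \<in> lists X"
    using w \<open>?S \<subseteq> lists X\<close> by auto
qed

lemma (in cring) lt_divides_imp_lt_in_ideal:
  assumes ord: "monomial_well_order X ord" and I: "ideal I (free_alg R X)"
    and g: "g \<in> carrier (free_alg R X)" "g \<noteq> \<zero>\<^bsub>free_alg R X\<^esub>" "lt R ord g \<in> I"
    and dvd: "lt_divides R X ord g f"
  shows "lt R ord f \<in> I"
proof -
  from dvd obtain d \<tau> where d: "d \<in> carrier R" "lc R ord f = lc R ord g \<otimes> d"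
    and \<tau>: "\<tau> \<in> env_basis X" "lm R ord f = act_word \<tau> (lm R ord g)"
    by (auto simp: lt_divides_def word_divides_def factor_def)
  have lg: "lc R ord g \<in> carrier R" using free_alg_coeff_closed[OF g(1)] by (simp add: lc_def)
  have "lt R ord f = d \<odot>\<^bsub>free_alg R X\<^esub> act R X \<tau> (lt R ord g)"
    unfolding lt_def
    using smult_act_fa_term[OF lg d(1) lm_in_lists[OF ord g(1,2)] \<tau>(1)] d \<tau>(2) lg
    by (simp add: m_comm)
  also have "\<dots> \<in> I" by (rule smult_act_in_ideal[OF I g(3) d(1) \<tau>(1)])
  finally show ?thesis .
qed

text \<open>
  A leading term that is divisible by another one lies in every ideal that contains the latter, so
  the inclusion of leading ideals need not be checked separately.
\<close>

lemma (in cring) strong_groebner_basisI: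
  assumes ord: "monomial_well_order X ord"
    and J: "J \<subseteq> carrier (free_alg R X)"
    and G: "countable G" "G \<subseteq> J - {\<zero>\<^bsub>free_alg R X\<^esub>}"
    and dvd: "\<And>f. f \<in> J \<Longrightarrow> f \<noteq> \<zero>\<^bsub>free_alg R X\<^esub> \<Longrightarrow> \<exists>g\<in>G. lt_divides R X ord g f"
  shows "strong_groebner_basis R X ord J G"
proof -
  interpret A: ring "free_alg R X" by (rule free_alg_is_ring)
  have lt_closed: "lt R ord f \<in> carrier (free_alg R X)"
    if "f \<in> J" "f \<noteq> \<zero>\<^bsub>free_alg R X\<^esub>" for f
    unfolding lt_def lc_def using that J lm_in_lists[OF ord] free_alg_coeff_closed
    by (intro fa_term_closed) blast+
  let ?LG = "lt R ord ` (G - {\<zero>\<^bsub>free_alg R X\<^esub>})"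
  have sub: "?LG \<subseteq> carrier (free_alg R X)" using lt_closed G by auto
  have I: "ideal (lt_ideal R X ord G) (free_alg R X)"
    unfolding lt_ideal_def by (rule A.genideal_ideal[OF sub])
  have "lt R ord f \<in> lt_ideal R X ord G" if f: "f \<in> J" "f \<noteq> \<zero>\<^bsub>free_alg R X\<^esub>" for f
  proof -
    from dvd[OF f] obtain g where g: "g \<in> G" "lt_divides R X ord g f" by blast
    have "lt R ord g \<in> lt_ideal R X ord G"
      unfolding lt_ideal_def using A.genideal_self[OF sub] g G by auto
    moreover have "g \<in> carrier (free_alg R X)" "g \<noteq> \<zero>\<^bsub>free_alg R X\<^esub>" using g(1) G(2) J by auto
    ultimately show ?thesis
      using lt_divides_imp_lt_in_ideal[OF ord I _ _ _ g(2)] by blast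
  qed
  then have "lt_ideal R X ord J \<subseteq> lt_ideal R X ord G"
    unfolding lt_ideal_def[of _ _ _ J] by (intro A.genideal_minimal[OF I]) auto
  with G dvd show ?thesis unfolding strong_groebner_basis_def by auto
qed


section \<open>Arithmetic in residue class rings\<close>

lemma ZMod_eq_iff: "ZMod n x = ZMod n y \<longleftrightarrow> n dvd x - y"
  by (metis ZMod_eq_mod mod_eq_dvd_iff)

lemma ZFact_carrier: "C \<in> carrier (ZFact n) \<longleftrightarrow> (\<exists>k. C = ZMod n k)"
  by (auto simp: ZFact_def FactRing_def A_RCOSETS_def' ZMod_def a_r_coset_def)

lemma ZFact_ops:
  "\<zero>\<^bsub>ZFact n\<^esub> = ZMod n 0"
  "ZMod n x \<oplus>\<^bsub>ZFact n\<^esub> ZMod n y = ZMod n (x + y)"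
  "ZMod n x \<otimes>\<^bsub>ZFact n\<^esub> ZMod n y = ZMod n (x * y)"
proof -
  interpret I: ideal "Idl\<^bsub>\<Z>\<^esub> {n}" \<Z> by (rule int.genideal_ideal) simp
  show "\<zero>\<^bsub>ZFact n\<^esub> = ZMod n 0"
    by (auto simp: ZFact_defs ZMod_eq int_Idl)
  show "ZMod n x \<oplus>\<^bsub>ZFact n\<^esub> ZMod n y = ZMod n (x + y)"
    by (simp add: ZFact_defs ZMod_def I.a_rcos_sum)
  show "ZMod n x \<otimes>\<^bsub>ZFact n\<^esub> ZMod n y = ZMod n (x * y)"
    by (simp add: ZFact_defs ZMod_def I.rcoset_mult_add)
qed

text \<open>Up to a unit, a residue modulo \<open>n\<close> is the greatest common divisor of a representative with \<open>n\<close>.\<close>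

lemma ZMod_divides_iff: "ZMod n x divides\<^bsub>ZFact n\<^esub> ZMod n y \<longleftrightarrow> gcd x n dvd y"
proof -
  have "ZMod n x divides\<^bsub>ZFact n\<^esub> ZMod n y \<longleftrightarrow> (\<exists>d. n dvd y - x * d)"
    unfolding factor_def Bex_def ZFact_carrier by (metis ZFact_ops(3) ZMod_eq_iff)
  also have "\<dots> \<longleftrightarrow> gcd x n dvd y"
  proof
    assume "\<exists>d. n dvd y - x * d"
    then obtain d where "n dvd y - x * d" ..
    then have "gcd x n dvd (y - x * d) + x * d"
      by (intro dvd_add) (auto intro: dvd_trans)
    then show "gcd x n dvd y" by simp
  next
    assume "gcd x n dvd y"
    then obtain k where k: "y = gcd x n * k" ..
    obtain u v where uv: "u * x + v * n = gcd x n" using bezout_int by blast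
    have "y - x * (u * k) = n * (v * k)"
      unfolding k uv[symmetric] by (simp add: algebra_simps)
    then have "n dvd y - x * (u * k)" by simp
    then show "\<exists>d. n dvd y - x * d" ..
  qed
  finally show ?thesis .
qed


lemma ZMod_eq_zero_iff: "ZMod n x = \<zero>\<^bsub>ZFact n\<^esub> \<longleftrightarrow> n dvd x"
  by (simp add: ZFact_ops ZMod_eq_iff)

text \<open>
  Read modulo \<open>a b\<close>, this is the Chinese remainder theorem for divisibility: \<open>k\<close> divides \<open>n\<close> modulo \<open>a\<close>
  and is a unit modulo \<open>b\<close>, while \<open>l\<close> divides \<open>n\<close> modulo \<open>b\<close> and is a unit modulo \<open>a\<close>; hence \<open>k l\<close>
  divides \<open>n\<close> modulo both.
\<close>

lemma gcd_mult_dvd_of_coprime: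
  fixes k l a b n :: int
  assumes "coprime a b" "coprime k b" "coprime l a" "gcd k a dvd n" "gcd l b dvd n"
  shows "gcd (k * l) (a * b) dvd n"
proof -
  have "gcd (k * l) (a * b) dvd a * b" by simp
  then obtain c d where cd: "gcd (k * l) (a * b) = c * d" "c dvd a" "d dvd b"
    using division_decomp by blast
  have "c * d dvd k * l" unfolding cd(1)[symmetric] by simp
  then have "c dvd k * l" "d dvd k * l" by (auto dest: dvd_mult_left dvd_mult_right)
  moreover have "coprime c l" "coprime d k"
    using coprime_divisors[OF cd(2) dvd_refl, of l] coprime_divisors[OF cd(3) dvd_refl, of k] assms(2,3)
    by (simp_all add: coprime_commute)
  ultimately have "c dvd k" "d dvd l"
    by (simp_all add: coprime_dvd_mult_left_iff coprime_dvd_mult_right_iff)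
  then have "c dvd gcd k a" "d dvd gcd l b" using cd(2,3) by simp_all
  then have "c dvd n" "d dvd n" using assms(4,5) by (auto intro: dvd_trans)
  moreover have "coprime c d" using cd(2,3) assms(1) by (rule coprime_divisors)
  ultimately show ?thesis unfolding cd(1) by (rule divides_mult)
qed

lemma poly_proj_coeff:
  assumes "n dvd m" "f w = ZMod m k"
  shows "poly_proj n f w = ZMod n k"
  using assms by (simp add: poly_proj_def ZFact_proj_ZMod)

lemma poly_of_int_poly_const:
  "poly_of_int_poly m (fa_const \<Z> c) = fa_const (ZFact m) (ZMod m c)"
  by (simp add: fun_eq_iff poly_of_int_poly_def fa_term_def ZFact_ops)

text \<open>
  Reduction can only shrink the support, so the leading term is preserved as soon as its coefficient
  survives.
\<close>

lemma lm_poly_proj: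
  assumes ord: "monomial_well_order X ord" and "n dvd m"
    and f: "f \<in> carrier (free_alg (ZFact m) X)"
    and k: "lc (ZFact m) ord f = ZMod m k" "\<not> n dvd k"
  shows "lm (ZFact n) ord (poly_proj n f) = lm (ZFact m) ord f"
    and "lc (ZFact n) ord (poly_proj n f) = ZMod n k"
    and "poly_proj n f \<noteq> \<zero>\<^bsub>free_alg (ZFact n) X\<^esub>"
proof -
  note pc = poly_proj_coeff[OF \<open>n dvd m\<close>]
  let ?w = "lm (ZFact m) ord f"
  have "\<not> m dvd k" using k(2) \<open>n dvd m\<close> dvd_trans by blast
  then have nz: "f \<noteq> \<zero>\<^bsub>free_alg (ZFact m) X\<^esub>"
    using k(1) by (auto simp: lc_def free_alg_simps ZMod_eq_zero_iff[symmetric])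
  have c: "poly_proj n f ?w = ZMod n k"
    using k(1) by (intro pc) (simp add: lc_def)
  then have c0: "poly_proj n f ?w \<noteq> \<zero>\<^bsub>ZFact n\<^esub>" using k(2) by (simp add: ZMod_eq_zero_iff)
  show *: "lm (ZFact n) ord (poly_proj n f) = ?w"
  proof (rule lm_eqI[where R = "ZFact n" and f = "poly_proj n f", OF ord c0])
    fix v assume v: "poly_proj n f v \<noteq> \<zero>\<^bsub>ZFact n\<^esub>"
    obtain j where j: "f v = ZMod m j"
      using free_alg_coeff_closed[OF f, of v] ZFact_carrier by blast
    have "\<not> n dvd j" using v pc[of f, OF j] by (simp add: ZMod_eq_zero_iff)
    then have "f v \<noteq> \<zero>\<^bsub>ZFact m\<^esub>" using j \<open>n dvd m\<close> dvd_trans by (auto simp: ZMod_eq_zero_iff)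
    then show "(v, ?w) \<in> ord" by (rule lm_max[OF ord f nz])
  qed
  show "lc (ZFact n) ord (poly_proj n f) = ZMod n k" using c by (simp add: lc_def *)
  show "poly_proj n f \<noteq> \<zero>\<^bsub>free_alg (ZFact n) X\<^esub>" using c0 by (auto simp: free_alg_simps)
qed


section \<open>Overlaps of words\<close>

lemma overlap_env_basis:
  "overlap X p q \<tau> \<tau>' \<Longrightarrow> \<tau> \<in> env_basis X \<and> \<tau>' \<in> env_basis X"
  by (auto simp: overlap_def env_basis_def)

lemma word_divides_iff:
  "word_divides X p u \<longleftrightarrow> (\<exists>x\<in>lists X. \<exists>y\<in>lists X. u = x @ p @ y)"
  unfolding word_divides_def env_basis_def act_word_def by simp

text \<open>
  The smallest stretch of \<open>u\<close> containing an occurrence of \<open>p\<close> and an occurrence of \<open>q\<close> is an overlap of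
  the two: its left end is the start of whichever begins first, its right end the end of whichever
  ends last. The two choices give the four kinds of overlap relations.
\<close>

lemma word_divides_overlap:
  assumes "word_divides X p u" "word_divides X q u"
  obtains \<tau> \<tau>' where "overlap X p q \<tau> \<tau>'" "word_divides X (act_word \<tau> p) u"
proof -
  from assms obtain x1 y1 x2 y2 where
    L: "x1 \<in> lists X" "y1 \<in> lists X" "x2 \<in> lists X" "y2 \<in> lists X"
    and u: "u = x1 @ p @ y1" "u = x2 @ q @ y2"
    unfolding word_divides_iff by blast
  have eq: "x1 @ p @ y1 = x2 @ q @ y2" using u by simp
  have "\<exists>z. x1 = x2 @ z \<or> x2 = x1 @ z"
    using append_eq_append_conv2[THEN iffD1, OF eq] by blast
  moreover have "\<exists>z. y1 = z @ y2 \<or> y2 = z @ y1"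
    using append_eq_append_conv2[THEN iffD1, of "x1 @ p" y1 "x2 @ q" y2] eq by auto
  ultimately consider
      (1) z z' where "x2 = x1 @ z" "y1 = z' @ y2"
    | (2) z z' where "x1 = x2 @ z" "y2 = z' @ y1"
    | (3) z z' where "x2 = x1 @ z" "y2 = z' @ y1"
    | (4) z z' where "x1 = x2 @ z" "y1 = z' @ y2"
    by blast
  then show ?thesis
  proof cases
    case 1
    then have "overlap X p q ([], z') (z, [])" using L eq by (auto simp: overlap_def act_word_def)
    moreover have "word_divides X (act_word ([], z') p) u"
      unfolding word_divides_iff act_word_def
      by (intro bexI[of _ x1] bexI[of _ y2]) (use L u 1 in auto)
    ultimately show ?thesis by (rule that)
  next
    case 2
    then have "overlap X p q (z, []) ([], z')" using L eq by (auto simp: overlap_def act_word_def)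
    moreover have "word_divides X (act_word (z, []) p) u"
      unfolding word_divides_iff act_word_def
      by (intro bexI[of _ x2] bexI[of _ y1]) (use L u 2 in auto)
    ultimately show ?thesis by (rule that)
  next
    case 3
    then have "overlap X p q ([], []) (z, z')" using L eq by (auto simp: overlap_def act_word_def)
    moreover have "word_divides X (act_word ([], []) p) u"
      using assms(1) by (simp add: act_word_def)
    ultimately show ?thesis by (rule that)
  next
    case 4
    then have "overlap X p q (z, z') ([], [])" using L eq by (auto simp: overlap_def act_word_def)
    moreover have "word_divides X (act_word (z, z') p) u"
      unfolding word_divides_iff act_word_def
      by (intro bexI[of _ x2] bexI[of _ y2]) (use L u 4 in auto)
    ultimately show ?thesis by (rule that)
  qed
qed


section \<open>The overlap polynomials\<close>

text \<open>
  A scalar \<open>e\<close> that annihilates \<open>n\<close> modulo \<open>m\<close> sees the coefficients of a polynomial modulo \<open>n\<close> only, so \<open>g\<close>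
  may be replaced by the element of \<open>J\<close> with which it agrees modulo \<open>n\<close>.
\<close>

lemma smult_act_annihilator_in_ideal:
  assumes J: "ideal J (free_alg (ZFact m) X)" and "n dvd m" "m dvd e * n"
    and g: "g \<in> carrier (free_alg (ZFact m) X)" "poly_proj n g \<in> poly_proj n ` J"
    and c: "c \<in> carrier (ZFact m)" and \<tau>: "\<tau> \<in> env_basis X"
  shows "(ZMod m e \<otimes>\<^bsub>ZFact m\<^esub> c) \<odot>\<^bsub>free_alg (ZFact m) X\<^esub> act (ZFact m) X \<tau> g \<in> J"
proof -
  interpret R: cring "ZFact m" by (rule ZFact_is_cring)
  from g(2) obtain j where j: "j \<in> J" "poly_proj n g = poly_proj n j" by blast
  have jc: "j \<in> carrier (free_alg (ZFact m) X)"
    using J j(1) by (meson additive_subgroup.a_Hcarr ideal.axioms(1))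
  let ?k = "ZMod m e \<otimes>\<^bsub>ZFact m\<^esub> c"
  have kc: "?k \<in> carrier (ZFact m)" using c by (auto simp: ZFact_carrier ZFact_ops)
  have eq: "?k \<otimes>\<^bsub>ZFact m\<^esub> g v = ?k \<otimes>\<^bsub>ZFact m\<^esub> j v" for v
  proof -
    obtain x y z where xyz: "g v = ZMod m x" "j v = ZMod m y" "c = ZMod m z"
      using free_alg_coeff_closed[OF g(1)] free_alg_coeff_closed[OF jc] c ZFact_carrier by metis
    have "ZMod n x = ZMod n y"
      using poly_proj_coeff[OF \<open>n dvd m\<close>, of g, OF xyz(1)]
        poly_proj_coeff[OF \<open>n dvd m\<close>, of j, OF xyz(2)] j(2) by simp
    then obtain d where "x - y = n * d" by (auto simp: ZMod_eq_iff)
    then have "e * z * x - e * z * y = (e * n) * (z * d)" by (simp add: algebra_simps flip: right_diff_distrib)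
    then have "m dvd e * z * x - e * z * y" using \<open>m dvd e * n\<close> by simp
    then show ?thesis by (simp add: xyz ZFact_ops ZMod_eq_iff)
  qed
  have "?k \<odot>\<^bsub>free_alg (ZFact m) X\<^esub> act (ZFact m) X \<tau> g
      = ?k \<odot>\<^bsub>free_alg (ZFact m) X\<^esub> act (ZFact m) X \<tau> j"
  proof
    fix w
    show "(?k \<odot>\<^bsub>free_alg (ZFact m) X\<^esub> act (ZFact m) X \<tau> g) w
        = (?k \<odot>\<^bsub>free_alg (ZFact m) X\<^esub> act (ZFact m) X \<tau> j) w"
      by (cases "w \<in> range (act_word \<tau>)")
        (auto simp: free_alg_simps R.act_coeff[OF g(1) \<tau>] R.act_coeff[OF jc \<tau>] eq)
  qed
  then show ?thesis using R.smult_act_in_ideal[OF J j(1) kc \<tau>] by simp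
qed

lemma lt_overlap_poly:
  assumes ord: "monomial_well_order X ord"
    and g: "g \<in> carrier (free_alg (ZFact m) X)" "g \<noteq> \<zero>\<^bsub>free_alg (ZFact m) X\<^esub>"
    and h: "h \<in> carrier (free_alg (ZFact m) X)" "h \<noteq> \<zero>\<^bsub>free_alg (ZFact m) X\<^esub>"
    and lc: "lc (ZFact m) ord g = ZMod m k" "lc (ZFact m) ord h = ZMod m l"
    and bezout: "a * r + b * s = 1" and nz: "\<not> m dvd k * l"
    and ov: "overlap X (lm (ZFact m) ord g) (lm (ZFact m) ord h) \<tau> \<tau>'"
  defines "f \<equiv> overlap_poly m a b r s X ord g h \<tau> \<tau>'"
  shows "lm (ZFact m) ord f = act_word \<tau> (lm (ZFact m) ord g)"
    and "lc (ZFact m) ord f = ZMod m (k * l)"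
    and "f \<noteq> \<zero>\<^bsub>free_alg (ZFact m) X\<^esub>"
proof -
  interpret R: cring "ZFact m" by (rule ZFact_is_cring)
  let ?u = "lm (ZFact m) ord g" and ?v = "lm (ZFact m) ord h"
  let ?w = "act_word \<tau> ?u"
  from overlap_env_basis[OF ov] have \<tau>: "\<tau> \<in> env_basis X" "\<tau>' \<in> env_basis X" by auto
  have w: "?w = act_word \<tau>' ?v" using ov by (simp add: overlap_def)
  have f: "f x = ZMod m (a * r * k) \<otimes>\<^bsub>ZFact m\<^esub> act (ZFact m) X \<tau>' h x
      \<oplus>\<^bsub>ZFact m\<^esub> ZMod m (b * s * l) \<otimes>\<^bsub>ZFact m\<^esub> act (ZFact m) X \<tau> g x" for x
    by (simp add: f_def overlap_poly_def free_alg_simps lc ZFact_ops)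
  have "act (ZFact m) X \<tau>' h ?w = ZMod m l"
    unfolding w using R.act_coeff(1)[OF h(1) \<tau>(2)] lc(2) by (simp add: lc_def)
  moreover have "act (ZFact m) X \<tau> g ?w = ZMod m k"
    using R.act_coeff(1)[OF g(1) \<tau>(1)] lc(1) by (simp add: lc_def)
  moreover have "a * r * k * l + b * s * l * k = (a * r + b * s) * (k * l)"
    by (simp add: algebra_simps)
  ultimately have c: "f ?w = ZMod m (k * l)"
    using bezout by (simp add: f ZFact_ops)
  then have c0: "f ?w \<noteq> \<zero>\<^bsub>ZFact m\<^esub>" using nz by (simp add: ZMod_eq_zero_iff)
  have below: "(x, act_word \<sigma> (lm (ZFact m) ord p)) \<in> ord"
    if p: "p \<in> carrier (free_alg (ZFact m) X)" "p \<noteq> \<zero>\<^bsub>free_alg (ZFact m) X\<^esub>"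
      and \<sigma>: "\<sigma> \<in> env_basis X" and x: "act (ZFact m) X \<sigma> p x \<noteq> \<zero>\<^bsub>ZFact m\<^esub>" for p \<sigma> x
  proof -
    obtain y where y: "x = act_word \<sigma> y" using R.act_coeff(2)[OF p(1) \<sigma>] x by blast
    then have "p y \<noteq> \<zero>\<^bsub>ZFact m\<^esub>" using R.act_coeff(1)[OF p(1) \<sigma>] x by simp
    then show ?thesis
      unfolding y using lm_max[OF ord p] monomial_well_orderD(5)[OF ord _ \<sigma>] by blast
  qed
  show lm: "lm (ZFact m) ord f = ?w"
  proof (rule lm_eqI[where R = "ZFact m" and f = f, OF ord c0])
    fix x assume x: "f x \<noteq> \<zero>\<^bsub>ZFact m\<^esub>"
    have "act (ZFact m) X \<tau>' h x \<noteq> \<zero>\<^bsub>ZFact m\<^esub> \<or> act (ZFact m) X \<tau> g x \<noteq> \<zero>\<^bsub>ZFact m\<^esub>"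
      using x unfolding f by (auto simp: ZFact_ops)
    then show "(x, ?w) \<in> ord"
      using below[OF g \<tau>(1)] below[OF h \<tau>(2)] w by auto
  qed
  show "lc (ZFact m) ord f = ZMod m (k * l)" using c by (simp add: lc_def lm)
  show "f \<noteq> \<zero>\<^bsub>free_alg (ZFact m) X\<^esub>" using c0 by (auto simp: free_alg_simps)
qed

text \<open>
  The coprimality of \<open>k\<close> with \<open>b\<close> is what allows combining this divisor with one for the other modulus:
  multiplying by \<open>k\<close> does no harm modulo \<open>b\<close>. It holds because every common divisor of \<open>k\<close> and \<open>b\<close>
  divides \<open>gcd k m\<close>, hence also \<open>a\<close>.
\<close>

lemma lift_strong_groebner_divisor:
  assumes ord: "monomial_well_order X ord" and m: "m = a * b" and cop: "coprime a b"
    and G: "G \<subseteq> carrier (free_alg (ZFact m) X)"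
    and sgb: "strong_groebner_basis (ZFact a) X ord (poly_proj a ` J)
        (poly_proj a ` G - {\<zero>\<^bsub>free_alg (ZFact a) X\<^esub>})"
    and const: "poly_of_int_poly m (fa_const \<Z> a) \<in> G"
    and lcs: "\<forall>g \<in> G. g \<noteq> poly_of_int_poly m (fa_const \<Z> a) \<longrightarrow>
           \<not> ZMod m a divides\<^bsub>ZFact m\<^esub> lc (ZFact m) ord g \<and>
           lc (ZFact m) ord g divides\<^bsub>ZFact m\<^esub> ZMod m a"
    and f: "f \<in> J" "f \<in> carrier (free_alg (ZFact m) X)"
    and n: "lc (ZFact m) ord f = ZMod m n" "\<not> m dvd n"
  obtains g k where "g \<in> G" "g \<noteq> \<zero>\<^bsub>free_alg (ZFact m) X\<^esub>"
    "word_divides X (lm (ZFact m) ord g) (lm (ZFact m) ord f)"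
    "lc (ZFact m) ord g = ZMod m k" "coprime k b" "gcd k a dvd n"
proof (cases "a dvd n")
  case True
  \<comment> \<open>The leading coefficient of \<open>f\<close> vanishes modulo \<open>a\<close>, so the constant \<open>a\<close> divides the leading term;
    it is nonzero modulo \<open>m\<close>, for otherwise \<open>m\<close> would divide \<open>n\<close>.\<close>
  let ?g = "fa_const (ZFact m) (ZMod m a)"
  have "\<not> m dvd a" using True n(2) dvd_trans by blast
  then have nz: "ZMod m a \<noteq> \<zero>\<^bsub>ZFact m\<^esub>" by (simp add: ZMod_eq_zero_iff)
  have lm: "lm (ZFact m) ord ?g = []"
    by (rule lm_eqI[OF ord])
      (use nz monomial_well_orderD(4)[OF ord, of "[]" "[]"] in \<open>auto simp: fa_term_def split: if_splits\<close>)
  have fnz: "f \<noteq> \<zero>\<^bsub>free_alg (ZFact m) X\<^esub>"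
    using n by (auto simp: lc_def free_alg_simps ZMod_eq_zero_iff[symmetric])
  show ?thesis
  proof (rule that[of ?g a])
    show "?g \<in> G" using const by (simp add: poly_of_int_poly_const)
    show "?g \<noteq> \<zero>\<^bsub>free_alg (ZFact m) X\<^esub>"
      using nz by (auto simp: free_alg_simps fa_term_def fun_eq_iff)
    show "word_divides X (lm (ZFact m) ord ?g) (lm (ZFact m) ord f)"
      unfolding lm word_divides_def env_basis_def act_word_def
      by (rule bexI[of _ "(lm (ZFact m) ord f, [])"]) (use lm_in_lists[OF ord f(2) fnz] in auto)
    show "lc (ZFact m) ord ?g = ZMod m a" unfolding lc_def lm by (simp add: fa_term_def)
  qed (use cop True in auto)
next
  case False
  have am: "a dvd m" by (simp add: m)
  note pf = lm_poly_proj[OF ord am f(2) n(1) False]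
  from sgb pf(3) f(1) obtain g where g: "g \<in> G" "poly_proj a g \<noteq> \<zero>\<^bsub>free_alg (ZFact a) X\<^esub>"
    and dvd: "lt_divides (ZFact a) X ord (poly_proj a g) (poly_proj a f)"
    unfolding strong_groebner_basis_def by blast
  have gc: "g \<in> carrier (free_alg (ZFact m) X)" using g(1) G by blast
  \<comment> \<open>The constant \<open>a\<close> reduces to zero, so \<open>g\<close> is subject to the conditions on leading coefficients.\<close>
  have "poly_proj a (poly_of_int_poly m (fa_const \<Z> a)) = \<zero>\<^bsub>free_alg (ZFact a) X\<^esub>"
  proof
    fix w
    show "poly_proj a (poly_of_int_poly m (fa_const \<Z> a)) w = \<zero>\<^bsub>free_alg (ZFact a) X\<^esub> w"
      using poly_proj_coeff[OF am, of "poly_of_int_poly m (fa_const \<Z> a)" w "fa_const \<Z> a w"]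
      by (auto simp: poly_of_int_poly_def free_alg_simps fa_term_def ZMod_eq_zero_iff)
  qed
  then have "g \<noteq> poly_of_int_poly m (fa_const \<Z> a)" using g(2) by auto
  with lcs g(1) have l: "\<not> ZMod m a divides\<^bsub>ZFact m\<^esub> lc (ZFact m) ord g"
    "lc (ZFact m) ord g divides\<^bsub>ZFact m\<^esub> ZMod m a" by auto
  obtain k where k: "lc (ZFact m) ord g = ZMod m k"
    using free_alg_coeff_closed[OF gc] ZFact_carrier unfolding lc_def by blast
  have "\<not> gcd a m dvd k" "gcd k m dvd a"
    using l unfolding k ZMod_divides_iff by auto
  then have ak: "\<not> a dvd k" by (auto simp: m)
  note pg = lm_poly_proj[OF ord am gc k ak]
  have kb: "coprime k b"
  proof (rule coprimeI)
    fix d assume "d dvd k" "d dvd b"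
    then have "d dvd gcd k m" by (simp add: m)
    then have "d dvd a" using \<open>gcd k m dvd a\<close> dvd_trans by blast
    then show "is_unit d" using \<open>d dvd b\<close> by (rule coprime_common_divisor[OF cop])
  qed
  show ?thesis
  proof (rule that[OF g(1) _ _ k kb])
    have "\<not> m dvd k" using ak am dvd_trans by blast
    then show "g \<noteq> \<zero>\<^bsub>free_alg (ZFact m) X\<^esub>"
      using k by (auto simp: lc_def free_alg_simps ZMod_eq_zero_iff[symmetric])
    show "word_divides X (lm (ZFact m) ord g) (lm (ZFact m) ord f)" "gcd k a dvd n"
      using dvd unfolding lt_divides_def pf pg ZMod_divides_iff by auto
  qed
qed

lemma zero_in_ideal: "ideal J (free_alg R X) \<Longrightarrow> \<zero>\<^bsub>free_alg R X\<^esub> \<in> J"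
  by (simp add: additive_subgroup.zero_closed ideal.axioms(1))

text \<open>
  Elements of \<open>G\<close> that reduce to zero are excluded from the Groebner basis, but zero is the reduction
  of an element of \<open>J\<close> as well.
\<close>

lemma poly_proj_in_image:
  assumes J: "ideal J (free_alg (ZFact m) X)" and "n dvd m"
    and sgb: "strong_groebner_basis (ZFact n) X ord (poly_proj n ` J)
           (poly_proj n ` G - {\<zero>\<^bsub>free_alg (ZFact n) X\<^esub>})"
    and "g \<in> G"
  shows "poly_proj n g \<in> poly_proj n ` J"
proof (cases "poly_proj n g = \<zero>\<^bsub>free_alg (ZFact n) X\<^esub>")
  case True
  have "poly_proj n \<zero>\<^bsub>free_alg (ZFact m) X\<^esub> = \<zero>\<^bsub>free_alg (ZFact n) X\<^esub>"
    using ZFact_proj_ZMod[OF \<open>n dvd m\<close>] by (simp add: poly_proj_def free_alg_simps ZFact_ops)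
  then show ?thesis using True zero_in_ideal[OF J] by (metis imageI)
next
  case False
  then show ?thesis using sgb \<open>g \<in> G\<close> unfolding strong_groebner_basis_def by blast
qed

lemma overlap_poly_in_ideal:
  assumes J: "ideal J (free_alg (ZFact m) X)" and m: "m = a * b"
    and g: "g \<in> carrier (free_alg (ZFact m) X)" "poly_proj a g \<in> poly_proj a ` J"
    and h: "h \<in> carrier (free_alg (ZFact m) X)" "poly_proj b h \<in> poly_proj b ` J"
    and \<tau>: "\<tau> \<in> env_basis X" "\<tau>' \<in> env_basis X"
  shows "overlap_poly m a b r s X ord g h \<tau> \<tau>' \<in> J"
proof -
  have "lc (ZFact m) ord p \<in> carrier (ZFact m)" if "p \<in> carrier (free_alg (ZFact m) X)" for p
    using free_alg_coeff_closed[OF that] by (simp add: lc_def)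
  then show ?thesis
    unfolding overlap_poly_def using g h \<tau>
    by (intro additive_subgroup.a_closed[OF ideal.axioms(1)[OF J]]
        smult_act_annihilator_in_ideal[OF J, of b] smult_act_annihilator_in_ideal[OF J, of a])
      (auto simp: m)
qed


section \<open>Strong Groebner bases modulo a product of coprime integers\<close>

theorem theorem17:
  fixes m a b r s :: int
    and X :: "'x set"
    and ord :: "'x list rel"
    and J G\<^sub>a G\<^sub>b :: "('x list \<Rightarrow> int set) set"
  assumes "m = a * b" and "m \<noteq> 0" and "\<not> is_unit m" and "\<not> prime_elem m"
    and "coprime a b" and "a * r + b * s = 1"
    and "finite X" and "monomial_well_order X ord"
    and "ideal J (free_alg (ZFact m) X)"
    and "countable G\<^sub>a" and "G\<^sub>a \<subseteq> carrier (free_alg (ZFact m) X)"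
    and "countable G\<^sub>b" and "G\<^sub>b \<subseteq> carrier (free_alg (ZFact m) X)"
    and "strong_groebner_basis (ZFact a) X ord (poly_proj a ` J)
           (poly_proj a ` G\<^sub>a - {\<zero>\<^bsub>free_alg (ZFact a) X\<^esub>})"
    and "strong_groebner_basis (ZFact b) X ord (poly_proj b ` J)
           (poly_proj b ` G\<^sub>b - {\<zero>\<^bsub>free_alg (ZFact b) X\<^esub>})"
    and "poly_of_int_poly m (fa_const \<Z> a) \<in> G\<^sub>a"
    and "poly_of_int_poly m (fa_const \<Z> b) \<in> G\<^sub>b"
    and "\<forall>g \<in> G\<^sub>a. g \<noteq> poly_of_int_poly m (fa_const \<Z> a) \<longrightarrow>
           \<not> ZMod m a divides\<^bsub>ZFact m\<^esub> lc (ZFact m) ord g \<and>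
           lc (ZFact m) ord g divides\<^bsub>ZFact m\<^esub> ZMod m a"
    and "\<forall>h \<in> G\<^sub>b. h \<noteq> poly_of_int_poly m (fa_const \<Z> b) \<longrightarrow>
           \<not> ZMod m b divides\<^bsub>ZFact m\<^esub> lc (ZFact m) ord h \<and>
           lc (ZFact m) ord h divides\<^bsub>ZFact m\<^esub> ZMod m b"
  shows "strong_groebner_basis (ZFact m) X ord J
           ({overlap_poly m a b r s X ord g h \<tau> \<tau>' | g h \<tau> \<tau>'.
               g \<in> G\<^sub>a \<and> h \<in> G\<^sub>b \<and>
               overlap X (lm (ZFact m) ord g) (lm (ZFact m) ord h) \<tau> \<tau>'}
            - {\<zero>\<^bsub>free_alg (ZFact m) X\<^esub>})"
proof -
  note m = \<open>m = a * b\<close> and ord = \<open>monomial_well_order X ord\<close>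
    and J = \<open>ideal J (free_alg (ZFact m) X)\<close>
  note Ga = \<open>G\<^sub>a \<subseteq> carrier (free_alg (ZFact m) X)\<close> and Gb = \<open>G\<^sub>b \<subseteq> carrier (free_alg (ZFact m) X)\<close>
  note sgb_a = assms(14) and sgb_b = assms(15)
  have m': "m = b * a" and cop': "coprime b a"
    using m \<open>coprime a b\<close> by (simp_all add: mult.commute coprime_commute)
  have am: "a dvd m" and bm: "b dvd m" by (simp_all add: m)
  interpret R: cring "ZFact m" by (rule ZFact_is_cring)
  interpret J: ideal J "free_alg (ZFact m) X" by (rule J)
  let ?F = "{overlap_poly m a b r s X ord g h \<tau> \<tau>' | g h \<tau> \<tau>'.
               g \<in> G\<^sub>a \<and> h \<in> G\<^sub>b \<and>
               overlap X (lm (ZFact m) ord g) (lm (ZFact m) ord h) \<tau> \<tau>'}"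
  show ?thesis
  proof (rule R.strong_groebner_basisI[OF ord])
    show "J \<subseteq> carrier (free_alg (ZFact m) X)" by (rule J.a_subset)
    have "countable (env_basis X)"
      unfolding env_basis_def using \<open>finite X\<close> by (simp add: countable_finite)
    then have "countable (G\<^sub>a \<times> G\<^sub>b \<times> env_basis X \<times> env_basis X)"
      using \<open>countable G\<^sub>a\<close> \<open>countable G\<^sub>b\<close> by simp
    moreover have "?F \<subseteq> (\<lambda>(g, h, \<tau>, \<tau>'). overlap_poly m a b r s X ord g h \<tau> \<tau>')
        ` (G\<^sub>a \<times> G\<^sub>b \<times> env_basis X \<times> env_basis X)"
      using overlap_env_basis by (fastforce simp: image_iff)
    ultimately show "countable (?F - {\<zero>\<^bsub>free_alg (ZFact m) X\<^esub>})"
      by (meson countable_Diff countable_image countable_subset)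
    have "?F \<subseteq> J"
    proof clarify
      fix g h \<tau> \<tau>'
      assume gh: "g \<in> G\<^sub>a" "h \<in> G\<^sub>b" "overlap X (lm (ZFact m) ord g) (lm (ZFact m) ord h) \<tau> \<tau>'"
      show "overlap_poly m a b r s X ord g h \<tau> \<tau>' \<in> J"
        using overlap_env_basis[OF gh(3)] gh(1,2) Ga Gb
        by (intro overlap_poly_in_ideal[OF J m] poly_proj_in_image[OF J am sgb_a]
            poly_proj_in_image[OF J bm sgb_b]) auto
    qed
    then show "?F - {\<zero>\<^bsub>free_alg (ZFact m) X\<^esub>} \<subseteq> J - {\<zero>\<^bsub>free_alg (ZFact m) X\<^esub>}" by blast
  next
    fix f assume f: "f \<in> J" "f \<noteq> \<zero>\<^bsub>free_alg (ZFact m) X\<^esub>"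
    have fc: "f \<in> carrier (free_alg (ZFact m) X)" using f(1) by (rule J.a_Hcarr)
    obtain n where n: "lc (ZFact m) ord f = ZMod m n"
      using free_alg_coeff_closed[OF fc] ZFact_carrier unfolding lc_def by blast
    have n0: "\<not> m dvd n"
      using lm_coeff_nonzero[OF ord fc f(2)] n by (simp add: lc_def ZMod_eq_zero_iff)
    obtain g k where g: "g \<in> G\<^sub>a" "g \<noteq> \<zero>\<^bsub>free_alg (ZFact m) X\<^esub>"
      "word_divides X (lm (ZFact m) ord g) (lm (ZFact m) ord f)"
      and k: "lc (ZFact m) ord g = ZMod m k" "coprime k b" "gcd k a dvd n"
      using lift_strong_groebner_divisor[OF ord m \<open>coprime a b\<close> Ga sgb_a assms(16,18) f(1) fc n n0] .
    obtain h l where h: "h \<in> G\<^sub>b" "h \<noteq> \<zero>\<^bsub>free_alg (ZFact m) X\<^esub>"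
      "word_divides X (lm (ZFact m) ord h) (lm (ZFact m) ord f)"
      and l: "lc (ZFact m) ord h = ZMod m l" "coprime l a" "gcd l b dvd n"
      using lift_strong_groebner_divisor[OF ord m' cop' Gb sgb_b assms(17,19) f(1) fc n n0] .
    have dvd: "gcd (k * l) m dvd n"
      unfolding m by (rule gcd_mult_dvd_of_coprime[OF \<open>coprime a b\<close> k(2) l(2) k(3) l(3)])
    \<comment> \<open>In particular \<open>g\<close> and \<open>h\<close> are not both the constants \<open>a\<close> and \<open>b\<close>.\<close>
    have nz: "\<not> m dvd k * l"
    proof
      assume "m dvd k * l"
      then have "m dvd gcd (k * l) m" by simp
      with dvd n0 show False using dvd_trans by blast
    qed
    obtain \<tau> \<tau>' where ov: "overlap X (lm (ZFact m) ord g) (lm (ZFact m) ord h) \<tau> \<tau>'"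
      and div: "word_divides X (act_word \<tau> (lm (ZFact m) ord g)) (lm (ZFact m) ord f)"
      using word_divides_overlap[OF g(3) h(3)] .
    let ?p = "overlap_poly m a b r s X ord g h \<tau> \<tau>'"
    have gc: "g \<in> carrier (free_alg (ZFact m) X)" and hc: "h \<in> carrier (free_alg (ZFact m) X)"
      using g(1) h(1) Ga Gb by auto
    note p = lt_overlap_poly[OF ord gc g(2) hc h(2) k(1) l(1) \<open>a * r + b * s = 1\<close> nz ov]
    have "lt_divides (ZFact m) X ord ?p f"
      unfolding lt_divides_def p n ZMod_divides_iff using dvd div by simp
    moreover have "?p \<in> ?F - {\<zero>\<^bsub>free_alg (ZFact m) X\<^esub>}"
      using g(1) h(1) ov p(3) by blast
    ultimately show "\<exists>p\<in>?F - {\<zero>\<^bsub>free_alg (ZFact m) X\<^esub>}. lt_divides (ZFact m) X ord p f"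
      by blast
  qed
qed

end
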